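(* There exist universal constants $\tilde c,\tilde C>0$, and for every $p\in[1,2)$ there is a constant $C_p>0$ depending only on $p$, such that the following holds. Let $p\in[1,2)$, let $n\ge C_p$ be an integer, and let $t>0$ and $K>0$. Then there exist a random vector $X=(X_1,X_2,\dots,X_n)$ of independent real random variables with $\|X_i\|_{\psi_p}\le K$, $1\le i\le n$, and a convex function $f:\mathbb{R}^n\to\mathbb{R}$, $1$-Lipschitz with respect to the Euclidean metric, such that $$ \mathbb{P}\big\{f(X)-\mathrm{Med}\,f(X)\ge t\big\}\ge \tilde c\,\max\left(\exp\left(-\frac{\tilde C\,t^2}{K^2(\log n)^{2/p}}\right),\ \exp\left(-\frac{\tilde C\,t^p}{K^p}\right)\right) $$ and $$ \mathbb{P}\big\{f(X)-\mathrm{Med}\,f(X)\le -t\big\}\ge \tilde c\,\max\left(\exp\left(-\frac{\tilde C\,t^2}{K^2(\log n)^{2/p}}\right),\ \exp\left(-\frac{\tilde C\,t^p}{K^p}\right)\right). $$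
   Context: For a real random variable $Y$ and $p>0$, $\|Y\|_{\psi_p}:=\inf\{\lambda>0:\ \mathbb{E}\exp(|Y|^p/\lambda^p)\le 2\}$. $\mathrm{Med}\,Y$ denotes a median of $Y$, i.e. a number $m$ with $\mathbb{P}\{Y\ge m\}\ge 1/2$ and $\mathbb{P}\{Y\le m\}\ge 1/2$. "Universal constant" means a constant not depending on any of the other parameters (in particular not on $p$). $\log$ is the natural logarithm. *)

theory Defs
  imports "HOL-Probability.Probability"
begin

text \<open>The integral is taken in the extended nonnegative reals, so it is infinite when the
  exponential moment diverges; if no \<open>\<lambda>\<close> is admissible, the norm is \<open>\<infinity>\<close>.\<close>

definition psi_norm :: "'a measure \<Rightarrow> real \<Rightarrow> ('a \<Rightarrow> real) \<Rightarrow> ennreal" where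
  "psi_norm M p Y =
     Inf {ennreal l | l. l > 0 \<and>
            (\<integral>\<^sup>+ \<omega>. ennreal (exp (\<bar>Y \<omega>\<bar> powr p / l powr p)) \<partial>M) \<le> 2}"

definition is_median :: "'a measure \<Rightarrow> ('a \<Rightarrow> real) \<Rightarrow> real \<Rightarrow> bool" where
  "is_median M Y m \<longleftrightarrow>
     \<P>(\<omega> in M. Y \<omega> \<ge> m) \<ge> 1 / 2 \<and> \<P>(\<omega> in M. Y \<omega> \<le> m) \<ge> 1 / 2"

text \<open>Since the dimension is quantified inside the theorem, \<open>\<real>\<^sup>n\<close> is the set of extensional
  functions on \<open>{1..n}\<close>, with Euclidean norm \<^const>\<open>L2_set\<close>. Functions on \<open>\<real>\<^sup>n\<close> are only
  constrained on this carrier.\<close>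

definition Rn :: "nat \<Rightarrow> (nat \<Rightarrow> real) set" where
  "Rn n = {1..n} \<rightarrow>\<^sub>E UNIV"

definition convex_on_Rn :: "nat \<Rightarrow> ((nat \<Rightarrow> real) \<Rightarrow> real) \<Rightarrow> bool" where
  "convex_on_Rn n f \<longleftrightarrow>
     (\<forall>x\<in>Rn n. \<forall>y\<in>Rn n. \<forall>u\<in>{0..1}.
        f (\<lambda>i\<in>{1..n}. (1 - u) * x i + u * y i) \<le> (1 - u) * f x + u * f y)"

definition lipschitz_on_Rn :: "real \<Rightarrow> nat \<Rightarrow> ((nat \<Rightarrow> real) \<Rightarrow> real) \<Rightarrow> bool" where
  "lipschitz_on_Rn L n f \<longleftrightarrow>
     (\<forall>x\<in>Rn n. \<forall>y\<in>Rn n. \<bar>f x - f y\<bar> \<le> L * L2_set (\<lambda>i. x i - y i) {1..n})"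

definition random_vector :: "nat \<Rightarrow> (nat \<Rightarrow> 'a \<Rightarrow> real) \<Rightarrow> 'a \<Rightarrow> (nat \<Rightarrow> real)" where
  "random_vector n X \<omega> = (\<lambda>i\<in>{1..n}. X i \<omega>)"

end

theory Submission imports Defs "HOL-Real_Asymp.Real_Asymp" begin

text \<open>
  Put \<open>L = ln n\<close> and \<open>s = t / (K L\<^sup>1\<^sup>/\<^sup>p)\<close>. The two exponents to be realised are then \<open>s\<^sup>2\<close> and
  \<open>t\<^sup>p / K\<^sup>p = s\<^sup>p L\<close>, up to a constant factor. Since the vector and the function may depend on
  \<open>t\<close>, the larger of the two tails can be produced by an example of its own, and the exponent
  \<open>s\<^sup>2\<close> is the smaller one exactly when \<open>s\<^sup>2\<close> is at most \<open>L\<close> to the power \<open>2 / (2 - p)\<close>.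

  Heavy tail. A single coordinate suffices: if \<open>x\<^sub>1\<close> takes the values \<open>t\<close> and \<open>-t\<close> with probability
  \<open>exp (- t\<^sup>p / K\<^sup>p) / 2\<close> each and is \<open>0\<close> otherwise, then its \<open>\<psi>\<^sub>p\<close>-norm is at most \<open>K\<close>, its only
  median is \<open>0\<close>, and it deviates by \<open>t\<close> with just this probability (lemma
  \<open>deviates_heavy_tail\<close>).

  Gaussian tail. Let each coordinate be \<open>a = K (L / 2)\<^sup>1\<^sup>/\<^sup>p\<close> with probability \<open>q\<close> and \<open>0\<close> otherwise;
  the norm constraint is met once \<open>q\<close> is at most \<open>1 / sqrt n\<close>. The Euclidean norm of the vector
  is \<open>a * sqrt N\<close> with \<open>N\<close> binomial of mean \<open>\<mu> = n q\<close>, and \<open>\<mu>\<close> is still free. Take \<open>\<mu>\<close> of order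
  \<open>s\<^sup>2 + 1\<close>. By a Chernoff bound, \<open>N < \<mu> / 4\<close> and \<open>N > 3 \<mu>\<close> each have probability below \<open>1 / 2\<close>, so
  the median of the norm is of order \<open>a * sqrt \<mu>\<close>, hence at least of order \<open>t\<close>. The far more drastic
  events \<open>N = 0\<close> and \<open>N \<ge> 9 \<mu>\<close> move the norm away from its median by a constant fraction of
  \<open>a * sqrt \<mu>\<close>, and by explicit binomial weights their probability is still exponential in \<open>-\<mu>\<close>,
  hence in \<open>-s\<^sup>2\<close> up to a constant factor (lemmas \<open>sparse_norm_deviation\<close> and
  \<open>deviates_gaussian\<close>).

  The constraint on \<open>q\<close> requires \<open>\<mu>\<close>, that is \<open>s\<^sup>2\<close>, to be at most about \<open>sqrt n\<close>. In the Gaussian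
  regime \<open>s\<^sup>2\<close> is at most a power of \<open>ln n\<close>, so this holds once \<open>n\<close> exceeds a threshold depending
  on \<open>p\<close>; the threshold blows up as \<open>p\<close> approaches \<open>2\<close>, because the power does.
\<close>

section \<open>Medians\<close>

lemma median_le:
  fixes P :: "'a pmf"
  assumes m: "is_median P Y m" and u: "measure_pmf.prob P {x. Y x > u} < 1 / 2"
  shows "m \<le> u"
proof (rule ccontr)
  assume "\<not> m \<le> u"
  then have "measure_pmf.prob P {x. Y x \<ge> m} \<le> measure_pmf.prob P {x. Y x > u}"
    by (intro measure_pmf.finite_measure_mono) auto
  with m u show False unfolding is_median_def by simp
qed

lemma median_ge:
  fixes P :: "'a pmf"
  assumes m: "is_median P Y m" and l: "measure_pmf.prob P {x. Y x < l} < 1 / 2"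
  shows "l \<le> m"
proof (rule ccontr)
  assume "\<not> l \<le> m"
  then have "measure_pmf.prob P {x. Y x \<le> m} \<le> measure_pmf.prob P {x. Y x < l}"
    by (intro measure_pmf.finite_measure_mono) auto
  with m l show False unfolding is_median_def by simp
qed

text \<open>A median is only ever located through two events of probability below \<open>1 / 2\<close>; this reduces
  a deviation from an unknown median to deviations from the explicit bounds \<open>l\<close> and \<open>u\<close>.\<close>

lemma deviation_from_median:
  fixes P :: "'a pmf"
  assumes "is_median P Y m"
    and "measure_pmf.prob P {x. Y x > u} < 1 / 2" "measure_pmf.prob P {x. Y x < l} < 1 / 2"
    and "\<epsilon> \<le> measure_pmf.prob P {x. Y x \<ge> u + t}"
    and "\<epsilon> \<le> measure_pmf.prob P {x. Y x \<le> l - t}"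
  shows "\<epsilon> \<le> \<P>(x in P. Y x - m \<ge> t) \<and> \<epsilon> \<le> \<P>(x in P. Y x - m \<le> - t)"
proof -
  have "m \<le> u" "l \<le> m" using assms median_le median_ge by blast+
  then have "measure_pmf.prob P {x. Y x \<ge> u + t} \<le> \<P>(x in P. Y x - m \<ge> t)"
    and "measure_pmf.prob P {x. Y x \<le> l - t} \<le> \<P>(x in P. Y x - m \<le> - t)"
    by (auto intro!: measure_pmf.finite_measure_mono)
  with assms show ?thesis by linarith
qed

section \<open>Independent copies of a discrete distribution\<close>

definition iid_pmf :: "nat \<Rightarrow> real pmf \<Rightarrow> (nat \<Rightarrow> real) pmf" where
  "iid_pmf n D = Pi_pmf {1..n} 0 (\<lambda>_. D)"

lemma indep_vars_iid_pmf:
  "prob_space.indep_vars (iid_pmf n D) (\<lambda>_. borel) (\<lambda>i \<omega>. \<omega> i) {1..n}"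
proof -
  have "prob_space.indep_vars (iid_pmf n D) (\<lambda>_. count_space UNIV) (\<lambda>i \<omega>. \<omega> i) {1..n}"
    unfolding iid_pmf_def by (rule indep_vars_Pi_pmf) simp
  then show ?thesis
    by (rule prob_space.indep_vars_compose2[OF measure_pmf.prob_space_axioms]) auto
qed

lemma iid_pmf_component: "i \<in> {1..n} \<Longrightarrow> map_pmf (\<lambda>\<omega>. \<omega> i) (iid_pmf n D) = D"
  unfolding iid_pmf_def by (subst Pi_pmf_component) auto

lemma psi_norm_iid_pmf_le:
  assumes i: "i \<in> {1..n}" and K: "K > 0"
    and D: "(\<integral>\<^sup>+ x. ennreal (exp (\<bar>x\<bar> powr p / K powr p)) \<partial>measure_pmf D) \<le> 2"
  shows "psi_norm (iid_pmf n D) p (\<lambda>\<omega>. \<omega> i) \<le> ennreal K"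
proof -
  have "(\<integral>\<^sup>+ \<omega>. ennreal (exp (\<bar>\<omega> i\<bar> powr p / K powr p)) \<partial>iid_pmf n D)
      = (\<integral>\<^sup>+ x. ennreal (exp (\<bar>x\<bar> powr p / K powr p)) \<partial>map_pmf (\<lambda>\<omega>. \<omega> i) (iid_pmf n D))"
    by simp
  also have "\<dots> \<le> 2" unfolding iid_pmf_component[OF i] by (rule D)
  finally show ?thesis
    unfolding psi_norm_def using K by (intro Inf_lower) auto
qed

section \<open>Convex Lipschitz functions\<close>

lemma convex_lipschitz_L2_set:
  "convex_on_Rn n (\<lambda>x. L2_set x {1..n})" "lipschitz_on_Rn 1 n (\<lambda>x. L2_set x {1..n})"
proof -
  show "convex_on_Rn n (\<lambda>x. L2_set x {1..n})"
    unfolding convex_on_Rn_def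
  proof (intro ballI)
    fix x y :: "nat \<Rightarrow> real" and u :: real assume u: "u \<in> {0..1}"
    have "L2_set (\<lambda>i\<in>{1..n}. (1 - u) * x i + u * y i) {1..n}
        = L2_set (\<lambda>i. (1 - u) * x i + u * y i) {1..n}" by (intro L2_set_cong) auto
    also have "\<dots> \<le> L2_set (\<lambda>i. (1 - u) * x i) {1..n} + L2_set (\<lambda>i. u * y i) {1..n}"
      by (rule L2_set_triangle_ineq)
    also have "\<dots> = (1 - u) * L2_set x {1..n} + u * L2_set y {1..n}"
      using u by (simp add: L2_set_right_distrib)
    finally show "L2_set (\<lambda>i\<in>{1..n}. (1 - u) * x i + u * y i) {1..n}
        \<le> (1 - u) * L2_set x {1..n} + u * L2_set y {1..n}" .
  qed
  have le: "L2_set x {1..n} - L2_set y {1..n} \<le> L2_set (\<lambda>i. x i - y i) {1..n}"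
    for x y :: "nat \<Rightarrow> real"
    using L2_set_triangle_ineq[of "\<lambda>i. x i - y i" y "{1..n}"] by simp
  have sym: "L2_set (\<lambda>i. y i - x i) {1..n} = L2_set (\<lambda>i. x i - y i) {1..n}"
    for x y :: "nat \<Rightarrow> real"
    by (simp add: L2_set_def power2_commute)
  show "lipschitz_on_Rn 1 n (\<lambda>x. L2_set x {1..n})"
    unfolding lipschitz_on_Rn_def
  proof (intro ballI)
    fix x y :: "nat \<Rightarrow> real"
    show "\<bar>L2_set x {1..n} - L2_set y {1..n}\<bar> \<le> 1 * L2_set (\<lambda>i. x i - y i) {1..n}"
      using le[of x y] le[of y x] sym[of x y] by (simp add: abs_le_iff)
  qed
qed

lemma convex_lipschitz_coordinate:
  assumes "i \<in> {1..n}"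
  shows "convex_on_Rn n (\<lambda>x. x i)" "lipschitz_on_Rn 1 n (\<lambda>x. x i)"
proof -
  show "convex_on_Rn n (\<lambda>x. x i)" using assms by (simp add: convex_on_Rn_def)
  have "\<bar>x i - y i\<bar> \<le> L2_set (\<lambda>i. x i - y i) {1..n}" for x y :: "nat \<Rightarrow> real"
  proof -
    have "(x i - y i)\<^sup>2 \<le> (\<Sum>i\<in>{1..n}. (x i - y i)\<^sup>2)"
      using assms by (intro member_le_sum) auto
    then show ?thesis unfolding L2_set_def using real_sqrt_le_mono by fastforce
  qed
  then show "lipschitz_on_Rn 1 n (\<lambda>x. x i)" by (simp add: lipschitz_on_Rn_def)
qed

section \<open>The tail of a single coordinate\<close>

text \<open>The mass \<open>q\<close> sits at each of \<open>t\<close> and \<open>- t\<close>: the first coin decides whether the value is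
  nonzero, the second one decides its sign.\<close>

definition sym_pmf :: "real \<Rightarrow> real \<Rightarrow> real pmf" where
  "sym_pmf q t = map_pmf (\<lambda>(b, s). if b then (if s then t else - t) else 0)
     (pair_pmf (bernoulli_pmf (2 * q)) (bernoulli_pmf (1 / 2)))"

lemma prob_sym_pmf:
  assumes q: "0 \<le> q" "q \<le> 1 / 2" and t: "t > 0" and A: "0 \<notin> A"
  shows "t \<in> A \<Longrightarrow> - t \<notin> A \<Longrightarrow> measure_pmf.prob (sym_pmf q t) A = q"
    and "t \<notin> A \<Longrightarrow> - t \<in> A \<Longrightarrow> measure_pmf.prob (sym_pmf q t) A = q"
proof -
  let ?g = "\<lambda>(b, s). if b then (if s then t else - t) else (0::real)"
  { assume "t \<in> A" "- t \<notin> A"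
    then have "?g -` A = {(True, True)}" using A by (auto split: if_splits)
    then show "measure_pmf.prob (sym_pmf q t) A = q"
      using q by (simp add: sym_pmf_def measure_pmf_single pmf_pair) }
  { assume "t \<notin> A" "- t \<in> A"
    then have "?g -` A = {(True, False)}" using A by (auto split: if_splits)
    then show "measure_pmf.prob (sym_pmf q t) A = q"
      using q by (simp add: sym_pmf_def measure_pmf_single pmf_pair) }
qed

text \<open>This \<open>q\<close> is the largest one for which the two atoms contribute at most \<open>1\<close> to the exponential
  moment.\<close>

lemma sym_pmf_exp_moment:
  assumes t: "t > 0" and K: "K > 0" and q: "q = exp (- (t powr p / K powr p)) / 2"
  shows "(\<integral>\<^sup>+ x. ennreal (exp (\<bar>x\<bar> powr p / K powr p)) \<partial>sym_pmf q t) \<le> 2"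
proof -
  define E where "E = exp (t powr p / K powr p)"
  have E: "E \<ge> 1" unfolding E_def by simp
  have qE: "q = 1 / (2 * E)" unfolding q E_def by (simp add: exp_minus field_simps)
  have q01: "0 \<le> 2 * q" "2 * q \<le> 1" using E by (auto simp: qE)
  have "(\<integral>\<^sup>+ x. ennreal (exp (\<bar>x\<bar> powr p / K powr p)) \<partial>sym_pmf q t)
      = ennreal E * ennreal (2 * q) + 1 * ennreal (1 - 2 * q)"
  proof -
    let ?P = "pair_pmf (bernoulli_pmf (2 * q)) (bernoulli_pmf (1 / 2))"
    have "(\<integral>\<^sup>+ x. ennreal (exp (\<bar>x\<bar> powr p / K powr p)) \<partial>sym_pmf q t)
        = (\<integral>\<^sup>+ z. (if fst z then ennreal E else 1) \<partial>measure_pmf ?P)"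
      unfolding sym_pmf_def nn_integral_map_pmf
      using t by (intro nn_integral_cong) (auto simp: E_def split: prod.split)
    also have "\<dots> = (\<integral>\<^sup>+ b. (if b then ennreal E else 1) \<partial>measure_pmf (map_pmf fst ?P))"
      by (simp only: nn_integral_map_pmf)
    finally show ?thesis using q01 by (simp add: map_fst_pair_pmf)
  qed
  also have "\<dots> = ennreal (E * (2 * q) + (1 - 2 * q))"
    using E q01 by (simp add: ennreal_mult'[symmetric] ennreal_plus[symmetric] del: ennreal_plus)
  also have "\<dots> \<le> ennreal 2" using E q01 by (intro ennreal_leI) (simp add: qE)
  finally show ?thesis by simp
qed

section \<open>Binomial estimates\<close>

lemma exp_le_one_minus_power:
  assumes "0 \<le> q" "q \<le> 1 / 2"
  shows "exp (- 2 * q * real n) \<le> (1 - q) ^ n"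
proof -
  have "- 2 * q \<le> - q - 2 * q\<^sup>2"
    using assms mult_left_mono[of q "1 / 2" q] by (simp add: power2_eq_square)
  also have "\<dots> \<le> ln (1 - q)" using assms by (intro ln_one_minus_pos_lower_bound)
  finally have "exp (- 2 * q) \<le> 1 - q" using assms by (simp add: ln_ge_iff)
  then have "exp (- 2 * q) ^ n \<le> (1 - q) ^ n" by (intro power_mono) auto
  then show ?thesis by (simp add: exp_of_nat_mult[symmetric] mult_ac)
qed

text \<open>The binomial coefficient is at least \<open>(n / k)\<^sup>k\<close>, and the failures cost no more than a factor
  exponential in the mean \<open>n q\<close>. For \<open>k = 0\<close> the convention \<open>0 ^ 0 = 1\<close> makes this the estimate of
  the probability of no success at all.\<close>

lemma pmf_binomial_lower_bound:
  assumes q: "0 \<le> q" "q \<le> 1 / 2" and k: "k \<le> n"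
  shows "(real n * q / real k) ^ k * exp (- 2 * (real n * q)) \<le> pmf (binomial_pmf n q) k"
proof -
  have "exp (- 2 * (real n * q)) \<le> (1 - q) ^ n"
    using exp_le_one_minus_power[OF q, of n] by (simp add: mult_ac)
  also have "\<dots> \<le> (1 - q) ^ (n - k)" using q by (intro power_decreasing) auto
  finally have "(real n * q / real k) ^ k * exp (- 2 * (real n * q))
      \<le> (real n / real k) ^ k * q ^ k * (1 - q) ^ (n - k)"
    using q by (auto simp: power_mult_distrib[symmetric] intro!: mult_left_mono)
  also have "\<dots> \<le> real (n choose k) * q ^ k * (1 - q) ^ (n - k)"
    using q binomial_ge_n_over_k_pow_k[OF k, where 'a = real]
    by (intro mult_right_mono) auto
  also have "\<dots> = pmf (binomial_pmf n q) k" using q by simp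
  finally show ?thesis .
qed

text \<open>Already the single value \<open>k\<close> next to \<open>9 \<mu>\<close> is likely enough: there \<open>\<mu> / k \<ge> 1 / 10\<close>, and
  \<open>10 \<le> exp 4\<close>, so \<open>(\<mu> / k)\<^sup>k\<close> is exponential in \<open>- \<mu>\<close>. Rounding up keeps \<open>k \<le> 10 \<mu>\<close> because
  \<open>1 \<le> \<mu>\<close>.\<close>

lemma binomial_upper_tail:
  assumes q: "0 \<le> q" "q \<le> 1 / 2" and \<mu>: "\<mu> = real n * q" "1 \<le> \<mu>" "10 * \<mu> \<le> real n"
  shows "exp (- 42 * \<mu>) \<le> measure_pmf.prob (binomial_pmf n q) {k. 9 * \<mu> \<le> real k}"
proof -
  define k where "k = nat \<lceil>9 * \<mu>\<rceil>"
  have k: "9 * \<mu> \<le> real k" "real k \<le> 10 * \<mu>" "k \<le> n"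
    using \<mu> unfolding k_def by linarith+
  have "exp (- 40 * \<mu>) \<le> exp (- 4 * real k)" using k by simp
  also have "\<dots> = exp (- 4) ^ k" by (simp add: exp_of_nat_mult[symmetric] mult_ac)
  also have "\<dots> \<le> (\<mu> / real k) ^ k"
  proof (intro power_mono)
    have "10 \<le> exp (4 :: real)" using exp_lower_Taylor_quadratic[of "4::real"] by simp
    then have "exp (- 4 :: real) \<le> 1 / 10" by (simp add: exp_minus field_simps)
    also have "\<dots> \<le> \<mu> / real k" using k \<mu> by (simp add: field_simps)
    finally show "exp (- 4) \<le> \<mu> / real k" .
  qed auto
  finally have "exp (- 40 * \<mu>) * exp (- 2 * \<mu>) \<le> (\<mu> / real k) ^ k * exp (- 2 * \<mu>)"
    by (intro mult_right_mono) auto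
  also have "\<dots> \<le> pmf (binomial_pmf n q) k"
    using pmf_binomial_lower_bound[OF q k(3)] unfolding \<mu> by simp
  also have "\<dots> \<le> measure_pmf.prob (binomial_pmf n q) {k. 9 * \<mu> \<le> real k}"
    unfolding measure_pmf_single[symmetric] using k(1)
    by (intro measure_pmf.finite_measure_mono) auto
  finally show ?thesis by (simp add: exp_add[symmetric])
qed

text \<open>Markov's inequality for \<open>exp (\<theta> * k)\<close>. Leaving the sign of \<open>\<theta>\<close> open yields both the upper
  tail (\<open>\<theta> = 1\<close>) and the lower tail (\<open>\<theta> = - 1\<close>).\<close>

lemma binomial_chernoff:
  assumes q: "0 \<le> q" "q \<le> 1"
  shows "measure_pmf.prob (binomial_pmf n q) {k. y \<le> \<theta> * real k}
    \<le> exp (real n * q * (exp \<theta> - 1) - y)"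
proof -
  let ?B = "binomial_pmf n q"
  have q': "q \<in> {0..1}" using q by simp
  have mgf: "measure_pmf.expectation ?B (\<lambda>k. exp (\<theta> * real k)) = (q * exp \<theta> + (1 - q)) ^ n"
    unfolding expectation_binomial_pmf'[OF q'] binomial_ring
    by (intro sum.cong) (simp_all add: power_mult_distrib exp_of_nat_mult[symmetric] mult_ac)
  have "measure_pmf.prob ?B {k. y \<le> \<theta> * real k}
      = measure_pmf.prob ?B {k \<in> space ?B. exp (\<theta> * real k) \<ge> exp y}" by simp
  also have "\<dots> \<le> measure_pmf.expectation ?B (\<lambda>k. exp (\<theta> * real k)) / exp y"
    using q' by (intro integral_Markov_inequality_measure[where A = UNIV]) auto
  also have "\<dots> \<le> exp (q * (exp \<theta> - 1)) ^ n / exp y"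
    unfolding mgf
  proof (intro divide_right_mono power_mono)
    show "q * exp \<theta> + (1 - q) \<le> exp (q * (exp \<theta> - 1))"
      using exp_ge_add_one_self[of "q * (exp \<theta> - 1)"] by (simp add: algebra_simps)
    have "0 \<le> q * exp \<theta>" using q by simp
    then show "0 \<le> q * exp \<theta> + (1 - q)" using q by linarith
  qed auto
  also have "\<dots> = exp (real n * q * (exp \<theta> - 1) - y)"
    by (simp add: exp_of_nat_mult[symmetric] exp_diff mult_ac)
  finally show ?thesis .
qed

text \<open>The Chernoff exponents are \<open>(exp 1 - 4) * \<mu>\<close> and \<open>(exp (- 1) - 3 / 4) * \<mu>\<close>. Both coefficients are
  negative, so both exponents fall below \<open>- 1\<close> once \<open>\<mu>\<close> is a large enough constant.\<close>

lemma binomial_concentration: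
  assumes q: "0 \<le> q" "q \<le> 1" and \<mu>: "\<mu> = real n * q" "4 \<le> \<mu>"
  shows "measure_pmf.prob (binomial_pmf n q) {k. 3 * \<mu> < real k} < 1 / 2"
    and "measure_pmf.prob (binomial_pmf n q) {k. real k < \<mu> / 4} < 1 / 2"
proof -
  let ?B = "binomial_pmf n q"
  have e: "2 \<le> exp (1::real)" "exp (1::real) \<le> 11 / 4"
    using exp_ge_add_one_self[of "1::real"] e_less_272 by auto
  have half: "exp (- 1 :: real) \<le> 1 / 2" using e by (simp add: exp_minus field_simps)
  have lt: "exp (- (5 / 4)) < (1 / 2 :: real)"
    using half exp_less_mono[of "- (5 / 4)" "- 1 :: real"] by linarith
  have "measure_pmf.prob ?B {k. 3 * \<mu> < real k} \<le> measure_pmf.prob ?B {k. 3 * \<mu> \<le> 1 * real k}"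
    by (intro measure_pmf.finite_measure_mono) auto
  also have "\<dots> \<le> exp (\<mu> * (exp 1 - 1) - 3 * \<mu>)"
    using binomial_chernoff[OF q, of n "3 * \<mu>" 1] \<mu> by simp
  also have "\<dots> \<le> exp (- (5 / 4))"
  proof -
    have "\<mu> * (exp 1 - 1) \<le> \<mu> * (7 / 4)" using e \<mu> by (intro mult_left_mono) auto
    then show ?thesis using \<mu>(2) unfolding exp_le_cancel_iff by linarith
  qed
  finally show "measure_pmf.prob ?B {k. 3 * \<mu> < real k} < 1 / 2" using lt by linarith
  have e2: "exp (- 1 :: real) \<le> 4 / 10"
    using exp_lower_Taylor_quadratic[of "1::real"] by (simp add: exp_minus field_simps)
  have "measure_pmf.prob ?B {k. real k < \<mu> / 4} \<le> measure_pmf.prob ?B {k. - \<mu> / 4 \<le> - 1 * real k}"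
    by (intro measure_pmf.finite_measure_mono) auto
  also have "\<dots> \<le> exp (\<mu> * (exp (- 1) - 1) + \<mu> / 4)"
    using binomial_chernoff[OF q, of n "- \<mu> / 4" "- 1"] \<mu> by simp
  also have "\<dots> \<le> exp (- (5 / 4))"
  proof -
    have "\<mu> * (exp (- 1) - 1) \<le> \<mu> * (- (6 / 10))" using e2 \<mu> by (intro mult_left_mono) auto
    then show ?thesis using \<mu>(2) unfolding exp_le_cancel_iff by linarith
  qed
  finally show "measure_pmf.prob ?B {k. real k < \<mu> / 4} < 1 / 2" using lt by linarith
qed

section \<open>The Euclidean norm of a sparse random vector\<close>

definition sparse_pmf :: "real \<Rightarrow> real \<Rightarrow> real pmf" where
  "sparse_pmf q a = map_pmf (\<lambda>b. if b then a else 0) (bernoulli_pmf q)"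

lemma sparse_pmf_exp_moment:
  assumes a: "a > 0" and q: "0 \<le> q" "q \<le> 1" "q * exp (a powr p / K powr p) \<le> 1"
  shows "(\<integral>\<^sup>+ x. ennreal (exp (\<bar>x\<bar> powr p / K powr p)) \<partial>sparse_pmf q a) \<le> 2"
proof -
  let ?E = "exp (a powr p / K powr p)"
  have "(\<integral>\<^sup>+ x. ennreal (exp (\<bar>x\<bar> powr p / K powr p)) \<partial>sparse_pmf q a)
      = ennreal (?E * q + (1 - q))"
    using a q unfolding sparse_pmf_def
    by (simp add: ennreal_mult'[symmetric] ennreal_plus[symmetric] del: ennreal_plus)
  also have "\<dots> \<le> ennreal 2" using q by (intro ennreal_leI) (simp add: mult.commute)
  finally show ?thesis by simp
qed

text \<open>All nonzero entries equal \<open>a\<close>, so the norm depends on their number only.\<close>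

lemma L2_set_sparse_eq_binomial:
  assumes a: "a > 0" and q: "0 \<le> q" "q \<le> 1"
  shows "map_pmf (\<lambda>\<omega>. L2_set \<omega> {1..n}) (iid_pmf n (sparse_pmf q a))
       = map_pmf (\<lambda>k. a * sqrt (real k)) (binomial_pmf n q)"
proof -
  let ?B = "Pi_pmf {1..n} False (\<lambda>_. bernoulli_pmf q)"
  let ?v = "\<lambda>b. if b then a else 0"
  have L2: "L2_set (?v \<circ> h) {1..n} = a * sqrt (real (card {i \<in> {1..n}. h i}))" for h
  proof -
    have "(\<Sum>i = 1..n. (?v (h i))\<^sup>2) = (\<Sum>i = 1..n. if h i then a\<^sup>2 else 0)"
      by (intro sum.cong) auto
    also have "\<dots> = real (card {i \<in> {1..n}. h i}) * a\<^sup>2"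
      by (subst sum.inter_filter[symmetric]) auto
    finally show ?thesis using a by (simp add: L2_set_def real_sqrt_mult)
  qed
  have "iid_pmf n (sparse_pmf q a) = map_pmf (\<lambda>h. ?v \<circ> h) ?B"
    unfolding iid_pmf_def sparse_pmf_def by (rule Pi_pmf_map) auto
  then have "map_pmf (\<lambda>\<omega>. L2_set \<omega> {1..n}) (iid_pmf n (sparse_pmf q a))
      = map_pmf (\<lambda>h. a * sqrt (real (card {i \<in> {1..n}. h i}))) ?B"
    by (simp only: pmf.map_comp o_def L2[unfolded o_def])
  also have "\<dots> = map_pmf (\<lambda>k. a * sqrt (real k)) (binomial_pmf n q)"
    using q by (subst binomial_pmf_altdef'[of "{1..n}" n q False])
      (auto simp: pmf.map_comp o_def)
  finally show ?thesis .
qed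

text \<open>The median of \<open>a * sqrt N\<close> lies between \<open>a * sqrt (\<mu> / 4) = a * sqrt \<mu> / 2\<close> and
  \<open>a * sqrt (3 * \<mu>) \<le> 2 * (a * sqrt \<mu>)\<close>. The event \<open>N \<ge> 9 \<mu>\<close> lifts the norm to \<open>3 * (a * sqrt \<mu>)\<close>
  and \<open>N = 0\<close> lowers it to \<open>0\<close>; both leave room for a deviation of \<open>a * sqrt \<mu> / 4\<close>.\<close>

lemma sparse_norm_deviation:
  assumes a: "a > 0" and q: "0 \<le> q" "q \<le> 1 / 2"
    and \<mu>: "\<mu> = real n * q" "4 \<le> \<mu>" "10 * \<mu> \<le> real n"
    and t: "t \<le> a * sqrt \<mu> / 4"
    and m: "is_median (iid_pmf n (sparse_pmf q a)) (\<lambda>\<omega>. L2_set \<omega> {1..n}) m"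
  shows "exp (- 42 * \<mu>) \<le> \<P>(\<omega> in iid_pmf n (sparse_pmf q a). L2_set \<omega> {1..n} - m \<ge> t)
       \<and> exp (- 42 * \<mu>) \<le> \<P>(\<omega> in iid_pmf n (sparse_pmf q a). L2_set \<omega> {1..n} - m \<le> - t)"
proof -
  let ?P = "iid_pmf n (sparse_pmf q a)" and ?B = "binomial_pmf n q"
  have q1: "q \<le> 1" using q by simp
  have law: "measure_pmf.prob ?P {\<omega>. Q (L2_set \<omega> {1..n})}
      = measure_pmf.prob ?B {k. Q (a * sqrt (real k))}" for Q
  proof -
    have "measure_pmf.prob ?P {\<omega>. Q (L2_set \<omega> {1..n})}
        = measure_pmf.prob (map_pmf (\<lambda>\<omega>. L2_set \<omega> {1..n}) ?P) {x. Q x}"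
      by (simp add: vimage_def)
    also have "\<dots> = measure_pmf.prob ?B {k. Q (a * sqrt (real k))}"
      unfolding L2_set_sparse_eq_binomial[OF a q(1) q1] by (simp add: vimage_def)
    finally show ?thesis .
  qed
  have s3: "sqrt 3 \<le> 2" by (rule real_le_lsqrt) auto
  show ?thesis
  proof (rule deviation_from_median[OF m, where u = "a * sqrt (3 * \<mu>)" and l = "a * sqrt (\<mu> / 4)"])
    show "measure_pmf.prob ?P {\<omega>. L2_set \<omega> {1..n} > a * sqrt (3 * \<mu>)} < 1 / 2"
      unfolding law[of "\<lambda>x. x > a * sqrt (3 * \<mu>)"]
      using binomial_concentration(1)[OF q(1) q1 \<mu>(1,2)] a by simp
    show "measure_pmf.prob ?P {\<omega>. L2_set \<omega> {1..n} < a * sqrt (\<mu> / 4)} < 1 / 2"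
      unfolding law[of "\<lambda>x. x < a * sqrt (\<mu> / 4)"]
      using binomial_concentration(2)[OF q(1) q1 \<mu>(1,2)] a by simp
    have "exp (- 42 * \<mu>) \<le> measure_pmf.prob ?B {k. 9 * \<mu> \<le> real k}"
      using \<mu> by (intro binomial_upper_tail q) auto
    also have "\<dots> \<le> measure_pmf.prob ?B {k. a * sqrt (3 * \<mu>) + t \<le> a * sqrt (real k)}"
    proof (intro measure_pmf.finite_measure_mono subsetI CollectI)
      fix k assume "k \<in> {k. 9 * \<mu> \<le> real k}"
      then have "sqrt (9 * \<mu>) \<le> sqrt (real k)" by (simp only: mem_Collect_eq real_sqrt_le_iff)
      then have k: "3 * sqrt \<mu> \<le> sqrt (real k)" by (simp add: real_sqrt_mult)
      have "sqrt (3 * \<mu>) \<le> 2 * sqrt \<mu>" using s3 \<mu>(2) by (simp add: real_sqrt_mult)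
      then have "a * sqrt (3 * \<mu>) \<le> a * (2 * sqrt \<mu>)" using a by simp
      moreover have "a * (3 * sqrt \<mu>) \<le> a * sqrt (real k)" using k a by simp
      moreover have "0 \<le> a * sqrt \<mu>" using a \<mu>(2) by simp
      ultimately show "a * sqrt (3 * \<mu>) + t \<le> a * sqrt (real k)" using t by linarith
    qed auto
    finally show "exp (- 42 * \<mu>) \<le> measure_pmf.prob ?P {\<omega>. L2_set \<omega> {1..n} \<ge> a * sqrt (3 * \<mu>) + t}"
      unfolding law[of "\<lambda>x. x \<ge> a * sqrt (3 * \<mu>) + t"] .
    have "exp (- 42 * \<mu>) \<le> exp (- 2 * \<mu>)" using \<mu>(2) by simp
    also have "\<dots> \<le> pmf ?B 0" using pmf_binomial_lower_bound[OF q, of 0 n] \<mu>(1) by simp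
    also have "\<dots> \<le> measure_pmf.prob ?B {k. a * sqrt (real k) \<le> a * sqrt (\<mu> / 4) - t}"
    proof -
      have "0 \<le> a * sqrt \<mu>" using a \<mu>(2) by simp
      then have "t \<le> a * sqrt (\<mu> / 4)" using t by (simp add: real_sqrt_divide)
      then show ?thesis unfolding measure_pmf_single[symmetric]
        by (intro measure_pmf.finite_measure_mono) auto
    qed
    finally show "exp (- 42 * \<mu>) \<le> measure_pmf.prob ?P {\<omega>. L2_set \<omega> {1..n} \<le> a * sqrt (\<mu> / 4) - t}"
      unfolding law[of "\<lambda>x. x \<le> a * sqrt (\<mu> / 4) - t"] .
  qed
qed

section \<open>Gaussian and heavy tails\<close>

text \<open>The predicate isolates the choice of vector and function, so that the two tails can be realised
  separately and the probability \<open>\<epsilon>\<close> lowered to the required value afterwards.\<close>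

definition deviates :: "nat \<Rightarrow> real \<Rightarrow> real \<Rightarrow> real \<Rightarrow> real \<Rightarrow> bool" where
  "deviates n p K t \<epsilon> \<longleftrightarrow>
     (\<exists>(M :: (nat \<Rightarrow> real) measure) (X :: nat \<Rightarrow> (nat \<Rightarrow> real) \<Rightarrow> real) (f :: (nat \<Rightarrow> real) \<Rightarrow> real).
        prob_space M \<and>
        prob_space.indep_vars M (\<lambda>_. borel) X {1..n} \<and>
        (\<forall>i\<in>{1..n}. psi_norm M p (X i) \<le> ennreal K) \<and>
        convex_on_Rn n f \<and>
        lipschitz_on_Rn 1 n f \<and>
        (\<forall>m. is_median M (\<lambda>\<omega>. f (random_vector n X \<omega>)) m \<longrightarrow>
           \<P>(\<omega> in M. f (random_vector n X \<omega>) - m \<ge> t) \<ge> \<epsilon> \<and>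
           \<P>(\<omega> in M. f (random_vector n X \<omega>) - m \<le> - t) \<ge> \<epsilon>))"

lemma deviates_mono: "deviates n p K t \<epsilon> \<Longrightarrow> \<delta> \<le> \<epsilon> \<Longrightarrow> deviates n p K t \<delta>"
  unfolding deviates_def by (blast intro: order_trans)

lemma deviates_iid_pmf:
  assumes K: "K > 0"
    and moment: "(\<integral>\<^sup>+ x. ennreal (exp (\<bar>x\<bar> powr p / K powr p)) \<partial>measure_pmf D) \<le> 2"
    and f: "convex_on_Rn n f" "lipschitz_on_Rn 1 n f"
    and restrict: "\<And>\<omega>. f (restrict \<omega> {1..n}) = f \<omega>"
    and dev: "\<And>m. is_median (iid_pmf n D) f m \<Longrightarrow>
      \<epsilon> \<le> \<P>(\<omega> in iid_pmf n D. f \<omega> - m \<ge> t) \<and> \<epsilon> \<le> \<P>(\<omega> in iid_pmf n D. f \<omega> - m \<le> - t)"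
  shows "deviates n p K t \<epsilon>"
  unfolding deviates_def
proof (intro exI conjI ballI)
  show "prob_space (iid_pmf n D)" by (rule measure_pmf.prob_space_axioms)
  show "prob_space.indep_vars (iid_pmf n D) (\<lambda>_. borel) (\<lambda>i \<omega>. \<omega> i) {1..n}"
    by (rule indep_vars_iid_pmf)
  show "psi_norm (iid_pmf n D) p (\<lambda>\<omega>. \<omega> i) \<le> ennreal K" if "i \<in> {1..n}" for i
    using that K moment by (rule psi_norm_iid_pmf_le)
  have "f (random_vector n (\<lambda>i \<omega>. \<omega> i) \<omega>) = f \<omega>" for \<omega>
    using restrict[of \<omega>] by (simp add: random_vector_def)
  then show "\<forall>m. is_median (iid_pmf n D) (\<lambda>\<omega>. f (random_vector n (\<lambda>i \<omega>. \<omega> i) \<omega>)) m \<longrightarrow>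
      \<P>(\<omega> in iid_pmf n D. f (random_vector n (\<lambda>i \<omega>. \<omega> i) \<omega>) - m \<ge> t) \<ge> \<epsilon> \<and>
      \<P>(\<omega> in iid_pmf n D. f (random_vector n (\<lambda>i \<omega>. \<omega> i) \<omega>) - m \<le> - t) \<ge> \<epsilon>"
    using dev by simp
qed (use f in auto)

lemma deviates_heavy_tail:
  assumes n: "n \<ge> 1" and t: "t > 0" and K: "K > 0"
  shows "deviates n p K t (exp (- (t powr p / K powr p)) / 2)"
proof -
  define q where "q = exp (- (t powr p / K powr p)) / 2"
  have q: "0 \<le> q" "q < 1 / 2" using t K by (auto simp: q_def)
  let ?P = "iid_pmf n (sym_pmf q t)"
  have "1 \<in> {1..n}" using n by simp
  have law: "measure_pmf.prob ?P {\<omega>. Q (\<omega> 1)} = measure_pmf.prob (sym_pmf q t) {x. Q x}" for Q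
  proof -
    have "measure_pmf.prob ?P {\<omega>. Q (\<omega> 1)}
        = measure_pmf.prob (map_pmf (\<lambda>\<omega>. \<omega> 1) ?P) {x. Q x}" by (simp add: vimage_def)
    then show ?thesis unfolding iid_pmf_component[OF \<open>1 \<in> {1..n}\<close>] .
  qed
  have dev: "q \<le> \<P>(\<omega> in ?P. \<omega> 1 - m \<ge> t) \<and> q \<le> \<P>(\<omega> in ?P. \<omega> 1 - m \<le> - t)"
    if "is_median ?P (\<lambda>\<omega>. \<omega> 1) m" for m
    using q t
    by (intro deviation_from_median[OF that, where u = 0 and l = 0])
       (simp_all add: law[of "\<lambda>x. x > 0"] law[of "\<lambda>x. x < 0"] law[of "\<lambda>x. x \<ge> t"]
          law[of "\<lambda>x. x \<le> - t"] prob_sym_pmf del: One_nat_def)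
  show ?thesis
    unfolding q_def[symmetric]
  proof (rule deviates_iid_pmf[where f = "\<lambda>\<omega>. \<omega> 1", OF K sym_pmf_exp_moment[OF t K q_def]])
    show "convex_on_Rn n (\<lambda>\<omega>. \<omega> 1)" "lipschitz_on_Rn 1 n (\<lambda>\<omega>. \<omega> 1)"
      using \<open>1 \<in> {1..n}\<close> by (rule convex_lipschitz_coordinate)+
  qed (use dev n in auto)
qed

text \<open>Here \<open>a\<close> satisfies \<open>exp (a\<^sup>p / K\<^sup>p) = sqrt n\<close>, so \<open>\<mu> \<le> sqrt n\<close> bounds the contribution
  \<open>q * sqrt n\<close> of the atom at \<open>a\<close> to the exponential moment by \<open>1\<close>. In \<open>\<mu>\<close>, the factor \<open>64\<close> gives
  \<open>8 * s \<le> sqrt \<mu>\<close>, which absorbs the \<open>1 / 4\<close> in the deviation of the norm and the loss of at most a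
  factor \<open>2\<close> between \<open>L / 2\<close> and \<open>L\<close> to the power \<open>1 / p\<close>; the summand \<open>4\<close> keeps the median under
  control when \<open>s\<close> is small. From \<open>n \<ge> 400\<close> and \<open>\<mu> \<le> sqrt n\<close> it follows that \<open>20 * \<mu> \<le> n\<close>, so \<open>q\<close>
  is small.\<close>

lemma deviates_gaussian:
  assumes p: "1 \<le> p" and t: "t > 0" and K: "K > 0" and n: "400 \<le> real n"
    and s: "s = t / (K * ln (real n) powr (1 / p))"
    and \<mu>: "\<mu> = 64 * s\<^sup>2 + 4" "\<mu> \<le> sqrt (real n)"
  shows "deviates n p K t (exp (- 42 * \<mu>))"
proof -
  define L where "L = ln (real n)"
  define a where "a = K * (L / 2) powr (1 / p)"
  define q where "q = \<mu> / real n"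
  have L: "L > 0" using n by (simp add: L_def)
  have a: "a > 0" using K L by (simp add: a_def)
  have s0: "s \<ge> 0" using t K by (simp add: s)
  have \<mu>4: "\<mu> \<ge> 4" using \<mu>(1) by simp
  have "sqrt (20\<^sup>2) \<le> sqrt (real n)" using n by (intro real_sqrt_le_mono) simp
  then have r20: "20 \<le> sqrt (real n)" by simp
  have rr: "sqrt (real n) * sqrt (real n) = real n" by simp
  have "20 * \<mu> \<le> sqrt (real n) * sqrt (real n)" using r20 \<mu>(2) \<mu>4 by (intro mult_mono) auto
  then have \<mu>n: "20 * \<mu> \<le> real n" by simp
  have q: "0 \<le> q" "q \<le> 1 / 2" and \<mu>q: "\<mu> = real n * q"
    using \<mu>n \<mu>4 n by (auto simp: q_def field_simps)
  have "q * exp (a powr p / K powr p) \<le> 1"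
  proof -
    have "a powr p / K powr p = L / 2" using K L p by (simp add: a_def powr_mult powr_powr)
    then have "exp (a powr p / K powr p) = sqrt (real n)"
      using n by (simp add: L_def ln_sqrt[symmetric])
    then show ?thesis using \<mu>(2) n rr mult_right_mono[OF \<mu>(2), of "sqrt (real n)"]
      by (simp add: q_def field_simps)
  qed
  then have moment: "(\<integral>\<^sup>+ x. ennreal (exp (\<bar>x\<bar> powr p / K powr p)) \<partial>sparse_pmf q a) \<le> 2"
    using a q by (intro sparse_pmf_exp_moment) auto
  have ta: "t \<le> a * sqrt \<mu> / 4"
  proof -
    have "8 * s = sqrt ((8 * s)\<^sup>2)" using s0 by (simp only: real_sqrt_abs)
    also have "\<dots> \<le> sqrt \<mu>" unfolding \<mu>(1) by (intro real_sqrt_le_mono) (simp add: power_mult_distrib)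
    finally have "8 * s \<le> sqrt \<mu>" .
    have "(1 / 2) powr 1 \<le> (1 / 2) powr (1 / p)" using p by (intro powr_mono') auto
    then have "(1 / 2) * L powr (1 / p) \<le> (L / 2) powr (1 / p)"
      using L powr_mult[of "1 / 2" L "1 / p"] by (simp add: mult_right_mono)
    then have "K * (L powr (1 / p) / 2) \<le> a" using K unfolding a_def by simp
    then have "K * (L powr (1 / p) / 2) * (8 * s) \<le> a * sqrt \<mu>"
      using \<open>8 * s \<le> sqrt \<mu>\<close> a s0 K by (intro mult_mono) auto
    moreover have "K * L powr (1 / p) * s = t" using K L by (simp add: s L_def)
    ultimately show ?thesis by (simp add: mult_ac)
  qed
  have "10 * \<mu> \<le> real n" using \<mu>n \<mu>4 by simp
  note dev = sparse_norm_deviation[OF a q \<mu>q \<mu>4 this ta]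
  show ?thesis
    by (rule deviates_iid_pmf[OF K moment convex_lipschitz_L2_set _ dev])
       (auto intro: L2_set_cong)
qed

theorem proposition1p2:
  "\<exists>c C :: real. c > 0 \<and> C > 0 \<and>
    (\<forall>p :: real. 1 \<le> p \<and> p < 2 \<longrightarrow>
      (\<exists>Cp :: real. Cp > 0 \<and>
        (\<forall>(n :: nat) (t :: real) (K :: real). real n \<ge> Cp \<and> t > 0 \<and> K > 0 \<longrightarrow>
          (\<exists>(M :: (nat \<Rightarrow> real) measure) (X :: nat \<Rightarrow> (nat \<Rightarrow> real) \<Rightarrow> real)
             (f :: (nat \<Rightarrow> real) \<Rightarrow> real).
             prob_space M \<and>
             prob_space.indep_vars M (\<lambda>_. borel) X {1..n} \<and>
             (\<forall>i\<in>{1..n}. psi_norm M p (X i) \<le> ennreal K) \<and>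
             convex_on_Rn n f \<and>
             lipschitz_on_Rn 1 n f \<and>
             (\<forall>m. is_median M (\<lambda>\<omega>. f (random_vector n X \<omega>)) m \<longrightarrow>
                \<P>(\<omega> in M. f (random_vector n X \<omega>) - m \<ge> t) \<ge>
                  c * max (exp (- (C * t\<^sup>2 / (K\<^sup>2 * ln (real n) powr (2 / p)))))
                          (exp (- (C * t powr p / K powr p))) \<and>
                \<P>(\<omega> in M. f (random_vector n X \<omega>) - m \<le> - t) \<ge>
                  c * max (exp (- (C * t\<^sup>2 / (K\<^sup>2 * ln (real n) powr (2 / p)))))
                          (exp (- (C * t powr p / K powr p))))))))"
proof -
  \<comment> \<open>The factor \<open>exp (- 42 * (64 * s\<^sup>2 + 4))\<close> of the Gaussian case is \<open>exp (- 168) * exp (- 2688 * s\<^sup>2)\<close>.\<close>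
  define c :: real where "c = exp (- 168)"
  define C :: real where "C = 2688"
  have c: "c > 0" "c \<le> 1 / 2"
  proof -
    have "2 \<le> exp (168 :: real)" using exp_ge_add_one_self[of "168 :: real"] by linarith
    then show "c > 0" "c \<le> 1 / 2" by (auto simp: c_def exp_minus field_simps)
  qed
  have "\<exists>Cp :: real. Cp > 0 \<and> (\<forall>n t K. real n \<ge> Cp \<and> t > 0 \<and> K > 0 \<longrightarrow>
      deviates n p K t (c * max (exp (- (C * t\<^sup>2 / (K\<^sup>2 * ln (real n) powr (2 / p)))))
                                (exp (- (C * t powr p / K powr p)))))"
    if p: "1 \<le> p \<and> p < 2" for p :: real
  proof -
    \<comment> \<open>The Gaussian exponent is the smaller one as long as \<open>s\<^sup>2 \<le> L powr e\<close>.\<close>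
    define e where "e = 2 / (2 - p)"
    have e: "e > 0" using p by (simp add: e_def)
    then have "eventually (\<lambda>x :: real. 64 * ln x powr e + 4 \<le> sqrt x) at_top"
      by real_asymp
    then obtain N where N: "\<And>x :: real. x \<ge> N \<Longrightarrow> 64 * ln x powr e + 4 \<le> sqrt x"
      unfolding eventually_at_top_linorder by blast
    have "deviates n p K t (c * max (exp (- (C * t\<^sup>2 / (K\<^sup>2 * ln (real n) powr (2 / p)))))
                                (exp (- (C * t powr p / K powr p))))"
      if nN: "real n \<ge> max 400 N" and t: "t > 0" and K: "K > 0" for n t K
    proof -
      define L where "L = ln (real n)"
      have n: "real n \<ge> 400" using nN by simp
      have L: "L > 0" using n by (simp add: L_def)
      define s where "s = t / (K * L powr (1 / p))"
      have s: "s > 0" using t K L by (simp add: s_def)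
      have sq: "s\<^sup>2 = t\<^sup>2 / (K\<^sup>2 * L powr (2 / p))"
        using L by (simp add: s_def power_divide power_mult_distrib powr_power mult.commute)
      have tp: "t powr p / K powr p = s powr p * L"
        using t K L p by (simp add: s_def powr_divide powr_mult powr_powr)
      have s2: "s\<^sup>2 = s powr p * s powr (2 - p)"
        using s by (simp add: powr_add[symmetric])
      have Le: "(L powr e) powr ((2 - p) / 2) = L" "(s\<^sup>2) powr ((2 - p) / 2) = s powr (2 - p)"
      proof -
        have "e * ((2 - p) / 2) = 1" using p by (simp add: e_def)
        then show "(L powr e) powr ((2 - p) / 2) = L" using L by (simp add: powr_powr)
        have "s\<^sup>2 = s powr 2" using s by simp
        then show "(s\<^sup>2) powr ((2 - p) / 2) = s powr (2 - p)"
          by (simp only: powr_powr) (simp add: diff_divide_distrib)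
      qed
      show ?thesis
      proof (cases "s\<^sup>2 \<le> L powr e")
        case True
        then have "s powr (2 - p) \<le> L"
          using powr_mono2[of "(2 - p) / 2" "s\<^sup>2" "L powr e"] p Le by simp
        then have "s\<^sup>2 \<le> t powr p / K powr p" unfolding s2 tp by (intro mult_left_mono) auto
        then have "max (exp (- (C * s\<^sup>2))) (exp (- (C * (t powr p / K powr p)))) = exp (- (C * s\<^sup>2))"
          by (simp add: C_def)
        then have eq: "c * max (exp (- (C * t\<^sup>2 / (K\<^sup>2 * L powr (2 / p)))))
            (exp (- (C * t powr p / K powr p))) = exp (- 42 * (64 * s\<^sup>2 + 4))"
          unfolding sq by (simp add: c_def C_def exp_add[symmetric])
        have "64 * s\<^sup>2 + 4 \<le> 64 * L powr e + 4" using True by simp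
        also have "\<dots> \<le> sqrt (real n)" using N[of "real n"] nN by (simp add: L_def)
        finally have "deviates n p K t (exp (- 42 * (64 * s\<^sup>2 + 4)))"
          using p t K n by (intro deviates_gaussian[of p t K n s]) (auto simp: s_def L_def)
        then show ?thesis unfolding eq[symmetric] L_def .
      next
        case False
        then have "L \<le> s powr (2 - p)"
          using powr_mono2[of "(2 - p) / 2" "L powr e" "s\<^sup>2"] p Le by simp
        then have "t powr p / K powr p \<le> s\<^sup>2" unfolding s2 tp by (intro mult_left_mono) auto
        then have "max (exp (- (C * s\<^sup>2))) (exp (- (C * (t powr p / K powr p))))
            = exp (- (C * (t powr p / K powr p)))"
          by (simp add: C_def)
        also have "\<dots> \<le> exp (- (t powr p / K powr p))"
        proof -
          have "0 \<le> t powr p / K powr p" by simp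
          then show ?thesis
            using mult_right_mono[of 1 C "t powr p / K powr p"] by (simp add: C_def)
        qed
        finally have "c * max (exp (- (C * s\<^sup>2))) (exp (- (C * (t powr p / K powr p))))
            \<le> (1 / 2) * exp (- (t powr p / K powr p))"
          using c by (intro mult_mono) (auto simp: le_max_iff_disj)
        then have "c * max (exp (- (C * t\<^sup>2 / (K\<^sup>2 * L powr (2 / p)))))
            (exp (- (C * t powr p / K powr p))) \<le> exp (- (t powr p / K powr p)) / 2"
          unfolding sq by simp
        then show ?thesis
          using n deviates_mono[OF deviates_heavy_tail[of n t K p, OF _ t K]]
          unfolding L_def by simp
      qed
    qed
    then show ?thesis by (intro exI[of _ "max 400 N"]) auto
  qed
  then show ?thesis
    unfolding deviates_def using c
    by (intro exI[of _ c] exI[of _ C]) (auto simp: C_def)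
qed

end
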